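(* Let $G_1$ and $G_2$ be vertex-disjoint finite connected graphs with $n_1$ and $n_2$ vertices and distance matrices $D_1,D_2$. Suppose $G_1$ and $G_2$ have nonnegative curvature, i.e. $D_iw_i=n_i\cdot\mathbf{1}$ for some $w_i\in\mathbb{R}^{n_i}_{\geq 0}$, $i=1,2$. Let $G$ be the graph obtained from the disjoint union of $G_1$ and $G_2$ by adding one edge $e=\{u,v\}$ with $u\in V(G_1)$, $v\in V(G_2)$. Then $G$ has a curvature $w$ (i.e. $D_Gw=(n_1+n_2)\cdot\mathbf{1}$, where $D_G$ is the distance matrix of $G$) such that $w(u)\leq 0$, $w(v)\leq 0$, and $w(x)\geq 0$ for every other vertex $x$ of $G$.
   Context: For a finite connected graph with vertices $v_1,\dots,v_n$, the distance matrix is $D_{ij}=d(v_i,v_j)$ (shortest-path distance), $\mathbf{1}$ is the all-ones vector, and a curvature is a vector $w\in\mathbb{R}^n$, viewed as a function on vertices, with $Dw=n\cdot\mathbf{1}$. *)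

theory Defs
  imports Complex_Main "Graph_Theory.Digraph_Component" "Graph_Theory.Shortest_Path"
begin

text \<open>
  A finite simple undirected graph is a \<^locale>\<open>pair_graph\<close>: every undirected edge \<open>{x, y}\<close> is
  represented by the two arcs \<open>(x, y)\<close> and \<open>(y, x)\<close>. Vectors and matrices indexed by the vertices
  are functions on the vertex type, of which only the values on \<^const>\<open>pverts\<close> matter.
\<close>

definition dist_matrix :: "'a pair_pre_digraph \<Rightarrow> 'a \<Rightarrow> 'a \<Rightarrow> real" where
  "dist_matrix G x y = real_of_ereal (wf_digraph.\<mu> (with_proj G) (\<lambda>_. 1) x y)"

definition is_curvature :: "'a pair_pre_digraph \<Rightarrow> ('a \<Rightarrow> real) \<Rightarrow> bool" where
  "is_curvature G w \<longleftrightarrow>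
     (\<forall>x\<in>pverts G. (\<Sum>y\<in>pverts G. dist_matrix G x y * w y) = real (card (pverts G)))"

definition has_nonneg_curvature :: "'a pair_pre_digraph \<Rightarrow> bool" where
  "has_nonneg_curvature G \<longleftrightarrow> (\<exists>w. is_curvature G w \<and> (\<forall>x\<in>pverts G. 0 \<le> w x))"

definition bridge_join ::
  "'a pair_pre_digraph \<Rightarrow> 'a pair_pre_digraph \<Rightarrow> 'a \<Rightarrow> 'a \<Rightarrow> 'a pair_pre_digraph" where
  "bridge_join G1 G2 u v =
     \<lparr> pverts = pverts G1 \<union> pverts G2, parcs = parcs G1 \<union> parcs G2 \<union> {(u, v), (v, u)} \<rparr>"

lemma pair_graph_bridge_join:
  assumes "pair_graph G1" and "pair_graph G2"
    and "pverts G1 \<inter> pverts G2 = {}"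
    and "u \<in> pverts G1" and "v \<in> pverts G2"
  shows "pair_graph (bridge_join G1 G2 u v)"
proof -
  interpret A: pair_graph G1 by fact
  interpret B: pair_graph G2 by fact
  have "u \<noteq> v" using assms by auto
  have "symmetric (with_proj (bridge_join G1 G2 u v))"
    using A.arcs_symmetric B.arcs_symmetric
    by (auto simp: symmetric_def sym_def bridge_join_def)
  then show ?thesis
    using assms(4,5) \<open>u \<noteq> v\<close> A.pair_finite_verts B.pair_finite_verts
      A.pair_finite_arcs B.pair_finite_arcs A.pair_no_loops B.pair_no_loops
      A.wellformed' B.wellformed'
    by unfold_locales (auto simp: bridge_join_def)
qed

end

theory Submission
  imports Defs
begin

text \<open>
  If \<open>w\<^sub>i\<close> has total mass \<open>s\<^sub>i\<close>, the vector that equals \<open>(2 c / s\<^sub>i) w\<^sub>i\<close> on \<open>G\<^sub>i\<close>, lowered by \<open>c\<close> at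
  the two ends of the bridge, has mass \<open>c\<close> on either side. In the row of \<open>x \<in> G\<^sub>1\<close> the terms containing
  \<open>d(x, u)\<close> then cancel, so all rows equal \<open>2 c n\<^sub>1 / s\<^sub>1 + 2 c n\<^sub>2 / s\<^sub>2 + c\<close>, and \<open>c\<close> is chosen to make
  this \<open>n\<^sub>1 + n\<^sub>2\<close>. The value at an end of the bridge is nonpositive because a nonnegative curvature puts at
  most half of its mass on a single vertex.
\<close>

section \<open>Distances in a connected graph\<close>

locale connected_pair_graph = pair_graph G for G :: "'a pair_pre_digraph" +
  assumes conn: "connected (with_proj G)"
begin

text \<open>Connectedness makes the extended-real infimum \<open>\<mu>\<close> finite and attained;
  with unit costs it is the length of a walk. Later arguments can thus work with real distances and
  walk lengths.\<close>

lemma shortest_awalk: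
  assumes "x \<in> pverts G" "y \<in> pverts G"
  obtains p where "awalk x p y" "dist_matrix G x y = real (length p)"
    "\<And>q. awalk x q y \<Longrightarrow> length p \<le> length q"
proof -
  have "strongly_connected (with_proj G)"
    using symmetric_connected_imp_strongly_connected[OF sym_arcs conn] .
  then have "x \<rightarrow>\<^sup>*\<^bsub>with_proj G\<^esub> y"
    using assms by auto
  then obtain p where p: "apath x p y" "\<mu> (\<lambda>_. 1) x y = ereal (awalk_cost (\<lambda>_. 1) p)"
    using min_cost_awalk[of x y "\<lambda>_. 1"] by auto
  have cost: "awalk_cost (\<lambda>_. 1) q = real (length q)" for q
    by (induction q) auto
  show thesis
  proof
    show "awalk x p y" using p(1) by (rule awalkI_apath)
    show "dist_matrix G x y = real (length p)" by (simp add: dist_matrix_def p(2) cost)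
    show "length p \<le> length q" if "awalk x q y" for q
      using min_cost_le_walk_cost[OF that, of "\<lambda>_. 1"] by (simp add: p(2) cost)
  qed
qed

lemma dist_le_length:
  assumes "awalk x p y"
  shows "dist_matrix G x y \<le> real (length p)"
proof -
  have "x \<in> pverts G" "y \<in> pverts G"
    using awalk_hd_in_verts[OF assms] awalk_last_in_verts[OF assms] by simp_all
  then show ?thesis
    by (rule shortest_awalk) (use assms in simp)
qed

text \<open>
  Together with \<open>dist_arc\<close> below, this says that the distance to \<open>y\<close> is the largest function
  that vanishes at \<open>y\<close> and changes by at most one along each arc.
\<close>
lemma potential_le_dist:
  fixes f :: "'a \<Rightarrow> real"
  assumes "x \<in> pverts G" "y \<in> pverts G"
    and f: "\<And>a b. (a, b) \<in> parcs G \<Longrightarrow> f a \<le> f b + 1"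
  shows "f x - f y \<le> dist_matrix G x y"
proof -
  obtain p where p: "awalk x p y" and d: "dist_matrix G x y = real (length p)"
    using shortest_awalk assms by blast
  from p have "f x \<le> f y + real (length p)"
  proof (induction p arbitrary: x)
    case Nil
    then show ?case by (simp add: awalk_Nil_iff)
  next
    case (Cons e p)
    then show ?case
      using f[of "fst e" "snd e"] by (force simp: awalk_Cons_iff)
  qed
  with d show ?thesis by simp
qed

lemma dist_arc:
  assumes "(a, b) \<in> parcs G" "y \<in> pverts G"
  shows "dist_matrix G a y \<le> dist_matrix G b y + 1"
proof -
  have "b \<in> pverts G" using assms wellformed' by blast
  then obtain p where p: "awalk b p y" "dist_matrix G b y = real (length p)"
    using shortest_awalk assms by blast
  have "awalk a ((a, b) # p) y"
    using assms p by (simp add: awalk_Cons_iff)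
  from dist_le_length[OF this] show ?thesis
    by (simp add: p)
qed

lemma dist_self:
  assumes "x \<in> pverts G"
  shows "dist_matrix G x x = 0"
proof -
  obtain p :: "('a \<times> 'a) list" where "dist_matrix G x x = real (length p)"
    using shortest_awalk[OF assms assms] by blast
  moreover have "awalk x [] x"
    using assms by (simp add: awalk_Nil_iff)
  ultimately show ?thesis
    using dist_le_length[of x "[]" x] by simp
qed

text \<open>The distance to \<open>z\<close> is itself a potential: it changes by at most one along
  each arc.\<close>

lemma dist_triangle:
  assumes "x \<in> pverts G" "y \<in> pverts G" "z \<in> pverts G"
  shows "dist_matrix G x z \<le> dist_matrix G x y + dist_matrix G y z"
  using potential_le_dist[of x y "\<lambda>a. dist_matrix G a z"] dist_arc assms by fastforce

text \<open>The potential is now the distance from \<open>y\<close>. It grows by at most one along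
  an arc because the reversed arc is present as well.\<close>

lemma dist_sym_le:
  assumes "x \<in> pverts G" "y \<in> pverts G"
  shows "dist_matrix G y x \<le> dist_matrix G x y"
proof -
  have "dist_matrix G y a \<le> dist_matrix G y b + 1" if "(a, b) \<in> parcs G" for a b
  proof -
    have ab: "a \<in> pverts G" "b \<in> pverts G" "(b, a) \<in> parcs G"
      using that wellformed' arcs_symmetric by blast+
    then show ?thesis
      using dist_triangle[of y b a] dist_arc[of b a a] dist_self[of a] assms by linarith
  qed
  then show ?thesis
    using potential_le_dist[of x y "\<lambda>a. dist_matrix G y a"] dist_self assms by force
qed

lemma dist_sym:
  assumes "x \<in> pverts G" "y \<in> pverts G"
  shows "dist_matrix G x y = dist_matrix G y x"
  using dist_sym_le assms by (intro antisym) auto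

lemma dist_pos:
  assumes "x \<in> pverts G" "y \<in> pverts G" "x \<noteq> y"
  shows "0 < dist_matrix G x y"
proof -
  \<comment> \<open>The potential is the indicator of the vertices other than
    \<open>y\<close>.\<close>
  have "(if x = y then 0 else 1) - (if y = y then 0 else 1) \<le> dist_matrix G x y"
    using assms by (intro potential_le_dist) auto
  then show ?thesis using assms by simp
qed

section \<open>Mass of a nonnegative curvature\<close>

text \<open>On a single vertex the distance matrix is zero, while the curvature equation asks for
  the value 1.\<close>

lemma curvature_ex_other_vertex:
  assumes "is_curvature G w" "z \<in> pverts G"
  obtains x where "x \<in> pverts G" "x \<noteq> z"
proof (cases "pverts G = {z}")
  case True
  then show ?thesis
    using assms dist_self[of z] by (simp add: is_curvature_def)
qed (use assms in blast)

text \<open>If \<open>w\<close> vanished on all vertices, the row of \<open>z\<close> would be 0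
  instead of the positive vertex count. Positivity allows division by the mass later.\<close>

lemma curvature_sum_pos:
  assumes "is_curvature G w" "\<forall>x\<in>pverts G. 0 \<le> w x" "z \<in> pverts G"
  shows "0 < (\<Sum>y\<in>pverts G. w y)"
proof -
  have "(\<Sum>y\<in>pverts G. dist_matrix G z y * w y) = real (card (pverts G))"
    using assms by (simp add: is_curvature_def)
  moreover have "0 < card (pverts G)"
    using assms pair_finite_verts card_gt_0_iff by blast
  ultimately have "\<exists>y\<in>pverts G. w y \<noteq> 0"
    by (metis (no_types, lifting) mult_zero_right of_nat_0 of_nat_0_less_iff order_less_irrefl
        sum.neutral)
  then obtain y where "y \<in> pverts G" "0 < w y"
    using assms(2) by force
  then show ?thesis
    using assms(2) pair_finite_verts by (intro sum_pos2) auto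
qed

text \<open>
  Subtracting the curvature equation at \<open>z\<close> from the one at some \<open>x \<noteq> z\<close> and applying the triangle
  inequality bounds \<open>d(x, z) w(z)\<close> by \<open>d(x, z)\<close> times the mass outside \<open>z\<close>.
\<close>
lemma curvature_le_half_sum:
  assumes w: "is_curvature G w" and nn: "\<forall>x\<in>pverts G. 0 \<le> w x" and z: "z \<in> pverts G"
  shows "2 * w z \<le> (\<Sum>y\<in>pverts G. w y)"
proof -
  let ?d = "dist_matrix G" and ?V = "pverts G"
  obtain x where x: "x \<in> ?V" "x \<noteq> z"
    using curvature_ex_other_vertex[OF w z] .
  have "0 = (\<Sum>y\<in>?V. ?d z y * w y) - (\<Sum>y\<in>?V. ?d x y * w y)"
    using w x z by (simp add: is_curvature_def)
  also have "\<dots> = (\<Sum>y\<in>?V. (?d z y - ?d x y) * w y)"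
    by (simp add: sum_subtractf left_diff_distrib)
  also have "\<dots> = - ?d x z * w z + (\<Sum>y\<in>?V - {z}. (?d z y - ?d x y) * w y)"
    using z pair_finite_verts by (simp add: sum.remove[of _ z] dist_self)
  also have "(\<Sum>y\<in>?V - {z}. (?d z y - ?d x y) * w y) \<le> (\<Sum>y\<in>?V - {z}. ?d x z * w y)"
  proof (intro sum_mono mult_right_mono)
    fix y assume y: "y \<in> ?V - {z}"
    show "?d z y - ?d x y \<le> ?d x z"
      using dist_triangle[of z x y] dist_sym[of x z] x z y by simp
    show "0 \<le> w y" using nn y by simp
  qed
  also have "\<dots> = ?d x z * ((\<Sum>y\<in>?V. w y) - w z)"
    using z pair_finite_verts by (simp add: sum_distrib_left[symmetric] sum_diff1)
  finally have "0 \<le> ?d x z * ((\<Sum>y\<in>?V. w y) - 2 * w z)"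
    by (simp add: algebra_simps)
  then show ?thesis
    using dist_pos[of x z] x z by (simp add: zero_le_mult_iff)
qed

end

section \<open>Connectedness and distances of the joined graph\<close>

locale bridged_graphs =
  A: connected_pair_graph G1 + B: connected_pair_graph G2
  for G1 G2 :: "'a pair_pre_digraph" +
  fixes u v :: 'a
  assumes disjoint: "pverts G1 \<inter> pverts G2 = {}"
    and u: "u \<in> pverts G1" and v: "v \<in> pverts G2"
begin

abbreviation "bridged \<equiv> bridge_join G1 G2 u v"

lemma pverts_bridged: "pverts bridged = pverts G1 \<union> pverts G2"
  by (simp add: bridge_join_def)

text \<open>Together with \<open>bridged_swap\<close>, this transfers every fact proved for one side
  of the bridge to the other side.\<close>

lemma swap: "bridged_graphs G2 G1 v u"
  using disjoint u v by unfold_locales auto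

lemma bridged_swap: "bridge_join G2 G1 v u = bridged"
  by (simp add: bridge_join_def Un_ac insert_commute)

lemma pair_graph_bridged: "pair_graph bridged"
  by (rule pair_graph_bridge_join[OF A.pair_graph_axioms B.pair_graph_axioms disjoint u v])

text \<open>A target in \<open>G1\<close> is reached inside \<open>G1\<close>; otherwise the route
  goes to \<open>u\<close>, over the bridge to \<open>v\<close>, and on inside
  \<open>G2\<close>.\<close>

lemma bridged_reachable:
  assumes "x \<in> pverts G1" "y \<in> pverts bridged"
  shows "x \<rightarrow>\<^sup>*\<^bsub>with_proj bridged\<^esub> y"
proof -
  interpret J: pair_graph bridged
    by (rule pair_graph_bridged)
  have sub: "subgraph (with_proj G1) (with_proj bridged)" "subgraph (with_proj G2) (with_proj bridged)"
    unfolding subgraph_def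
    using A.wf_digraph_axioms B.wf_digraph_axioms J.wf_digraph_axioms
    by (simp_all add: compatible_def) (auto simp: bridge_join_def)
  have sc: "strongly_connected (with_proj G1)" "strongly_connected (with_proj G2)"
    using A.symmetric_connected_imp_strongly_connected[OF A.sym_arcs A.conn]
      B.symmetric_connected_imp_strongly_connected[OF B.sym_arcs B.conn] by blast+
  have one: "x \<rightarrow>\<^sup>*\<^bsub>with_proj bridged\<^esub> a" if "a \<in> pverts G1" for a
    using J.reachable_mono[OF _ sub(1)] sc(1) assms(1) that by auto
  have two: "v \<rightarrow>\<^sup>*\<^bsub>with_proj bridged\<^esub> b" if "b \<in> pverts G2" for b
    using J.reachable_mono[OF _ sub(2)] sc(2) v that by auto
  have "(u, v) \<in> parcs bridged"
    by (simp add: bridge_join_def)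
  with one[OF u] have "x \<rightarrow>\<^sup>*\<^bsub>with_proj bridged\<^esub> v"
    by (rule J.reachable_adj_trans)
  then show ?thesis
    using assms(2) one two pverts_bridged J.reachable_trans by auto
qed

lemma connected_bridged: "connected_pair_graph bridged"
proof -
  interpret J: pair_graph bridged
    by (rule pair_graph_bridged)
  have "strongly_connected (with_proj bridged)"
    using bridged_reachable bridged_graphs.bridged_reachable[OF swap] bridged_swap u pverts_bridged
    by (intro strongly_connectedI) auto
  then have "connected (with_proj bridged)"
    using J.reachable_mk_symmetricI by (auto simp: connected_def strongly_connected_def)
  then show ?thesis
    by unfold_locales
qed

text \<open>The left side, as a function of \<open>x\<close>, is the expected distance to
  \<open>z\<close>. It vanishes at \<open>z\<close>, changes by at most one along arcs of either
  graph and by exactly one along the bridge, so it is a potential. No walk has to be cut at the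
  bridge.\<close>

lemma dist_bridged_ge:
  assumes "x \<in> pverts bridged" "z \<in> pverts G2"
  shows "(if x \<in> pverts G1 then dist_matrix G1 x u + 1 + dist_matrix G2 v z
     else dist_matrix G2 x z) \<le> dist_matrix bridged x z"
proof -
  interpret J: connected_pair_graph bridged by (rule connected_bridged)
  let ?f = "\<lambda>x. if x \<in> pverts G1 then dist_matrix G1 x u + 1 + dist_matrix G2 v z
     else dist_matrix G2 x z"
  have zn: "z \<notin> pverts G1" "v \<notin> pverts G1" using assms disjoint v by auto
  have "?f a \<le> ?f b + 1" if "(a, b) \<in> parcs bridged" for a b
  proof -
    consider "(a, b) \<in> parcs G1" | "(a, b) \<in> parcs G2" | "a = u" "b = v" | "a = v" "b = u"
      using \<open>(a, b) \<in> parcs bridged\<close> by (auto simp: bridge_join_def)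
    then show ?thesis
    proof cases
      case 1
      then have "a \<in> pverts G1" "b \<in> pverts G1" using A.wellformed' by blast+
      then show ?thesis using A.dist_arc[OF 1 u] by simp
    next
      case 2
      then have "a \<notin> pverts G1" "b \<notin> pverts G1" using B.wellformed' disjoint by blast+
      then show ?thesis using B.dist_arc[OF 2 assms(2)] by simp
    qed (use A.dist_self[OF u] zn u in auto)
  qed
  then have "?f x - ?f z \<le> dist_matrix bridged x z"
    using assms pverts_bridged by (intro J.potential_le_dist) auto
  then show ?thesis
    using zn B.dist_self[OF assms(2)] by simp
qed

text \<open>Arcs of \<open>G2\<close> are arcs of the joined graph, so the joined distance to
  \<open>z\<close> is a potential on \<open>G2\<close>.\<close>

lemma dist_bridged_same_le:
  assumes "x \<in> pverts G2" "z \<in> pverts G2"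
  shows "dist_matrix bridged x z \<le> dist_matrix G2 x z"
proof -
  interpret J: connected_pair_graph bridged by (rule connected_bridged)
  have z: "z \<in> pverts bridged" using assms pverts_bridged by simp
  have "dist_matrix bridged x z - dist_matrix bridged z z \<le> dist_matrix G2 x z"
    using assms J.dist_arc[OF _ z]
    by (intro B.potential_le_dist) (auto simp: bridge_join_def)
  then show ?thesis using J.dist_self[OF z] by simp
qed

lemma dist_bridged_same:
  assumes "x \<in> pverts G2" "z \<in> pverts G2"
  shows "dist_matrix bridged x z = dist_matrix G2 x z"
proof (rule antisym[OF dist_bridged_same_le[OF assms]])
  have "x \<in> pverts bridged" "x \<notin> pverts G1"
    using assms disjoint pverts_bridged by auto
  then show "dist_matrix G2 x z \<le> dist_matrix bridged x z"
    using dist_bridged_ge[of x z] assms by simp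
qed

text \<open>The lower bound is \<open>dist_bridged_ge\<close>; the upper bound comes from passing
  through \<open>u\<close> and the bridge.\<close>

lemma dist_bridged_across:
  assumes x: "x \<in> pverts G1" and z: "z \<in> pverts G2"
  shows "dist_matrix bridged x z = dist_matrix G1 x u + 1 + dist_matrix G2 v z"
proof -
  interpret J: connected_pair_graph bridged by (rule connected_bridged)
  have V: "x \<in> pverts bridged" "z \<in> pverts bridged" "u \<in> pverts bridged" "v \<in> pverts bridged"
    using x z u v by (simp_all add: pverts_bridged)
  have "dist_matrix bridged x z \<le> dist_matrix bridged x u + dist_matrix bridged u z"
    using V by (intro J.dist_triangle)
  moreover have "dist_matrix bridged u z \<le> dist_matrix bridged v z + 1"
    using V by (intro J.dist_arc) (auto simp: bridge_join_def)
  moreover have "dist_matrix bridged x u = dist_matrix G1 x u"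
    using bridged_graphs.dist_bridged_same[OF swap x u] by (simp add: bridged_swap)
  ultimately show ?thesis
    using dist_bridged_same[OF v z] dist_bridged_ge[of x z] V x z by simp
qed

section \<open>The curvature equation of the joined graph\<close>

text \<open>Lowering \<open>w\<close> at \<open>u\<close> contributes \<open>- c * d(x, u)\<close>.
  The vertices of \<open>G2\<close> carry mass \<open>2 * c - c = c\<close> and contribute
  \<open>c * (d(x, u) + 1)\<close> plus a term free of \<open>x\<close>, so \<open>d(x, u)\<close>
  cancels. The result is symmetric in the two sides, as the swapped use requires.\<close>

lemma curvature_row:
  assumes w1: "is_curvature G1 w1" and w2: "is_curvature G2 w2"
    and x: "x \<in> pverts G1"
    and W1: "\<And>y. y \<in> pverts G1 \<Longrightarrow> w y = a * w1 y - (if y = u then c else 0)"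
    and W2: "\<And>y. y \<in> pverts G2 \<Longrightarrow> w y = b * w2 y - (if y = v then c else 0)"
    and b: "b * (\<Sum>y\<in>pverts G2. w2 y) = 2 * c"
  shows "(\<Sum>y\<in>pverts bridged. dist_matrix bridged x y * w y) =
    a * real (card (pverts G1)) + b * real (card (pverts G2)) + c"
proof -
  let ?d1 = "dist_matrix G1" and ?d2 = "dist_matrix G2"
  have same: "dist_matrix bridged x y = ?d1 x y" if "y \<in> pverts G1" for y
    using bridged_graphs.dist_bridged_same[OF swap x that] by (simp only: bridged_swap)
  have "(\<Sum>y\<in>pverts G1. dist_matrix bridged x y * w y) =
      (\<Sum>y\<in>pverts G1. a * (?d1 x y * w1 y) - (if y = u then c * ?d1 x u else 0))"
    by (intro sum.cong) (simp_all add: W1 same algebra_simps)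
  also have "\<dots> = a * real (card (pverts G1)) - c * ?d1 x u"
    using w1 x u A.pair_finite_verts
    by (simp add: sum_subtractf sum_distrib_left[symmetric] is_curvature_def)
  finally have 1: "(\<Sum>y\<in>pverts G1. dist_matrix bridged x y * w y) =
    a * real (card (pverts G1)) - c * ?d1 x u" .
  \<comment> \<open>Each distance is \<open>d(x, u) + 1\<close>, constant in \<open>y\<close>, plus
    an entry of the row of \<open>v\<close> in the matrix of \<open>G2\<close>, whose product with
    \<open>w2\<close> is known. The correction at \<open>v\<close> meets only the constant, as
    \<open>d(v, v) = 0\<close>.\<close>
  have "(\<Sum>y\<in>pverts G2. dist_matrix bridged x y * w y) =
      (\<Sum>y\<in>pverts G2. (?d1 x u + 1) * (b * w2 y) + b * (?d2 v y * w2 y)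
        - (if y = v then c * (?d1 x u + 1) else 0))"
    by (intro sum.cong) (simp_all add: dist_bridged_across[OF x] W2 B.dist_self[OF v] algebra_simps)
  also have "\<dots> = (?d1 x u + 1) * (b * (\<Sum>y\<in>pverts G2. w2 y))
      + b * (\<Sum>y\<in>pverts G2. ?d2 v y * w2 y) - c * (?d1 x u + 1)"
    using v B.pair_finite_verts by (simp add: sum_subtractf sum.distrib sum_distrib_left)
  also have "\<dots> = (?d1 x u + 1) * c + b * real (card (pverts G2))"
    using w2 v unfolding b by (simp add: is_curvature_def algebra_simps)
  finally show ?thesis
    using 1 disjoint A.pair_finite_verts B.pair_finite_verts
    by (simp add: pverts_bridged sum.union_disjoint algebra_simps)
qed

end

theorem theorem2:
  fixes G1 G2 :: "'a pair_pre_digraph" and u v :: 'a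
  assumes "pair_graph G1" and "connected (with_proj G1)"
    and "pair_graph G2" and "connected (with_proj G2)"
    and "pverts G1 \<inter> pverts G2 = {}"
    and "has_nonneg_curvature G1" and "has_nonneg_curvature G2"
    and "u \<in> pverts G1" and "v \<in> pverts G2"
  shows "\<exists>w. is_curvature (bridge_join G1 G2 u v) w \<and> w u \<le> 0 \<and> w v \<le> 0 \<and>
    (\<forall>x\<in>pverts (bridge_join G1 G2 u v) - {u, v}. 0 \<le> w x)"
proof -
  interpret bridged_graphs G1 G2 u v
    using assms by (simp add: bridged_graphs_def bridged_graphs_axioms_def
        connected_pair_graph_def connected_pair_graph_axioms_def)
  obtain w1 where w1: "is_curvature G1 w1" "\<forall>x\<in>pverts G1. 0 \<le> w1 x"
    using assms(6) unfolding has_nonneg_curvature_def by blast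
  obtain w2 where w2: "is_curvature G2 w2" "\<forall>x\<in>pverts G2. 0 \<le> w2 x"
    using assms(7) unfolding has_nonneg_curvature_def by blast
  define s1 s2 where "s1 = (\<Sum>y\<in>pverts G1. w1 y)" and "s2 = (\<Sum>y\<in>pverts G2. w2 y)"
  define n1 n2 where "n1 = real (card (pverts G1))" and "n2 = real (card (pverts G2))"
  \<comment> \<open>The common row value is \<open>c\<close> times this denominator.\<close>
  define c where "c = (n1 + n2) / (2 * n1 / s1 + 2 * n2 / s2 + 1)"
  define w where "w y = (if y \<in> pverts G1 then 2 * c / s1 * w1 y - (if y = u then c else 0)
    else 2 * c / s2 * w2 y - (if y = v then c else 0))" for y
  have s: "0 < s1" "0 < s2"
    using A.curvature_sum_pos[OF w1 u] B.curvature_sum_pos[OF w2 v] by (simp_all add: s1_def s2_def)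
  have n: "0 \<le> n1" "0 \<le> n2" by (simp_all add: n1_def n2_def)
  have denom: "0 < 2 * n1 / s1 + 2 * n2 / s2 + 1"
    using s n by (intro add_nonneg_pos add_nonneg_nonneg) auto
  have c: "0 \<le> c"
    using denom n by (simp add: c_def)
  have "c * (2 * n1 / s1 + 2 * n2 / s2 + 1) = n1 + n2"
    using denom by (simp add: c_def)
  then have total: "2 * c / s1 * n1 + 2 * c / s2 * n2 + c = n1 + n2"
    by (simp add: algebra_simps)
  have W1: "w y = 2 * c / s1 * w1 y - (if y = u then c else 0)" if "y \<in> pverts G1" for y
    using that by (simp add: w_def)
  have W2: "w y = 2 * c / s2 * w2 y - (if y = v then c else 0)" if "y \<in> pverts G2" for y
    using that disjoint by (auto simp: w_def)
  have "(\<Sum>y\<in>pverts bridged. dist_matrix bridged x y * w y) = n1 + n2"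
    if "x \<in> pverts bridged" for x
  proof (cases "x \<in> pverts G1")
    case True
    show ?thesis
      using curvature_row[OF w1(1) w2(1) True W1 W2] s total
      by (simp add: s2_def[symmetric] n1_def[symmetric] n2_def[symmetric])
  next
    case False
    then have "x \<in> pverts G2" using that pverts_bridged by auto
    \<comment> \<open>With the sides exchanged, the mass condition concerns \<open>w1\<close> and
      holds because \<open>2 * c / s1 * s1 = 2 * c\<close>.\<close>
    from bridged_graphs.curvature_row[OF swap w2(1) w1(1) this W2 W1] show ?thesis
      using s total
      by (simp add: s1_def[symmetric] n1_def[symmetric] n2_def[symmetric] bridged_swap)
  qed
  moreover have "real (card (pverts bridged)) = n1 + n2"
    using disjoint A.pair_finite_verts B.pair_finite_verts
    by (simp add: pverts_bridged card_Un_disjoint n1_def n2_def)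
  ultimately have "is_curvature bridged w"
    by (simp add: is_curvature_def)
  moreover have "w u \<le> 0"
  proof -
    \<comment> \<open>Since \<open>w u = c / s1 * (2 * w1 u - s1)\<close>, its sign is decided by
      the half-mass bound.\<close>
    have "c / s1 * (2 * w1 u) \<le> c / s1 * s1"
      using A.curvature_le_half_sum[OF w1 u] c s unfolding s1_def[symmetric]
      by (intro mult_left_mono) simp_all
    then show ?thesis using s W1[OF u] by (simp add: mult_ac)
  qed
  moreover have "w v \<le> 0"
  proof -
    have "c / s2 * (2 * w2 v) \<le> c / s2 * s2"
      using B.curvature_le_half_sum[OF w2 v] c s unfolding s2_def[symmetric]
      by (intro mult_left_mono) simp_all
    then show ?thesis using s W2[OF v] by (simp add: mult_ac)
  qed
  moreover have "\<forall>x\<in>pverts bridged - {u, v}. 0 \<le> w x"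
    using w1(2) w2(2) c s by (auto simp: pverts_bridged w_def)
  ultimately show ?thesis by (intro exI[of _ w] conjI)
qed

end
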